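(* Let $\lambda$ be the unique real root of $\lambda^3-\lambda^2-\lambda-1=0$. Let $x\in[0,1]$ be represented as $x=\left[0;\frac{\varepsilon_1}{a_1},\frac{\varepsilon_2}{a_2},\ldots\right]$ (odd continued fraction with zero integer part; finite if $x$ is rational, infinite if $x$ is irrational). Then the limit $F^0(x)=\lim_{n\to\infty}F^0_n(x)$ exists and $$F^0(x)=-\sum_{i\ge1}\frac{E_i}{\lambda^{A_i}},\qquad E_i=\prod_{j=1}^{i}(-\varepsilon_j),\qquad A_i=\sum_{j=1}^{i}a_j-1,$$ where the sum runs over all indices $i\ge1$ of the representation (so it is a finite sum when $x$ is rational, and an infinite sum when $x$ is irrational).
   Context: Every $x\in[0,1]$ is written uniquely as $$x=\left[0;\frac{\varepsilon_1}{a_1},\frac{\varepsilon_2}{a_2},\ldots\right]=\cfrac{\varepsilon_1}{a_1+\cfrac{\varepsilon_2}{a_2+\cdots}},$$ finite (of some length $l\ge 0$) if $x$ is rational and infinite if $x$ is irrational, where all $a_i$ are odd positive integers, $\varepsilon_i\in\{1,-1\}$, $\varepsilon_1=1$, and $a_j+\varepsilon_{j+1}\ge2$ for all $j\ge1$ for which $\varepsilon_{j+1}$ occurs; moreover, in the finite case, if the last partial quotient is $a_l=1$, then $\varepsilon_l=1$. (The number $0$ has $l=0$, and $1=\left[0;\frac11\right]$.) For rational $x\in[0,1]$ put $S^0(x)=\sum_{j=1}^l a_j$. For $n\ge1$ let $\mathcal{Y}_n=\{x\in\mathbb{Q}\cap[0,1]:S^0(x)\le n+1\}$, which is a finite set,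 and $$F^0_n(x)=\frac{\#\{\xi\in\mathcal{Y}_n:\xi\le x\}}{\#\mathcal{Y}_n},\qquad x\in[0,1].$$ *)

theory Defs
  imports Complex_Main "HOL-Library.Extended_Nat"
begin

text \<open>
  \<open>cf_frac m eps a k\<close> is the finite continued fraction with \<open>m\<close> levels
  \<open>eps k / (a k + eps (k+1) / (a (k+1) + \<dots> + eps (k+m-1) / a (k+m-1)))\<close>.
  For the digits admitted below, all denominators are positive, so division by zero
  does not occur.
\<close>

primrec cf_frac :: "nat \<Rightarrow> (nat \<Rightarrow> int) \<Rightarrow> (nat \<Rightarrow> nat) \<Rightarrow> nat \<Rightarrow> real" where
  "cf_frac 0 eps a k = 0"
| "cf_frac (Suc m) eps a k = of_int (eps k) / (of_nat (a k) + cf_frac m eps a (Suc k))"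

text \<open>
  Digits are indexed from 1 and \<open>L\<close> is the length of the expansion (possibly \<open>\<infinity>\<close>);
  values of \<open>eps\<close> and \<open>a\<close> at index 0 or beyond \<open>L\<close> are irrelevant.
  Finite expansions represent the rational numbers in \<open>[0,1]\<close>, infinite ones the irrational numbers;
  this is a consequence of the digit conditions and is not imposed separately.
\<close>

definition odd_cf_digits :: "enat \<Rightarrow> (nat \<Rightarrow> int) \<Rightarrow> (nat \<Rightarrow> nat) \<Rightarrow> bool" where
  "odd_cf_digits L eps a \<longleftrightarrow>
     (\<forall>i\<ge>1. enat i \<le> L \<longrightarrow> odd (a i) \<and> eps i \<in> {1, -1}) \<and>
     (1 \<le> L \<longrightarrow> eps 1 = 1) \<and>
     (\<forall>j\<ge>1. enat (Suc j) \<le> L \<longrightarrow> int (a j) + eps (Suc j) \<ge> 2) \<and>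
     (\<forall>l\<ge>1. L = enat l \<longrightarrow> a l = 1 \<longrightarrow> eps l = 1)"

definition odd_cf_expansion :: "real \<Rightarrow> enat \<Rightarrow> (nat \<Rightarrow> int) \<Rightarrow> (nat \<Rightarrow> nat) \<Rightarrow> bool" where
  "odd_cf_expansion x L eps a \<longleftrightarrow>
     odd_cf_digits L eps a \<and>
     (case L of
        enat l \<Rightarrow> x = cf_frac l eps a 1
      | \<infinity> \<Rightarrow> (\<lambda>m. cf_frac m eps a 1) \<longlonglongrightarrow> x)"

text \<open>Meaningful for rational \<open>x \<in> [0,1]\<close>, which have exactly one (finite) expansion.\<close>

definition S0 :: "real \<Rightarrow> nat" where
  "S0 x = (THE s. \<exists>l eps a. odd_cf_expansion x (enat l) eps a \<and> s = (\<Sum>j=1..l. a j))"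

definition Y_set :: "nat \<Rightarrow> real set" where
  "Y_set n = {x \<in> \<rat> \<inter> {0..1}. S0 x \<le> n + 1}"

definition F0n :: "nat \<Rightarrow> real \<Rightarrow> real" where
  "F0n n x = of_nat (card {\<xi> \<in> Y_set n. \<xi> \<le> x}) / of_nat (card (Y_set n))"

definition F0 :: "real \<Rightarrow> real" where
  "F0 x = lim (\<lambda>n. F0n n x)"

definition lam :: real where
  "lam = (THE r. r ^ 3 - r ^ 2 - r - 1 = 0)"

definition cf_E :: "(nat \<Rightarrow> int) \<Rightarrow> nat \<Rightarrow> int" where
  "cf_E eps i = (\<Prod>j=1..i. - eps j)"

text \<open>Used only for \<open>i \<ge> 1\<close>, where the sum is positive and the subtraction does not truncate.\<close>

definition cf_A :: "(nat \<Rightarrow> nat) \<Rightarrow> nat \<Rightarrow> nat" where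
  "cf_A a i = (\<Sum>j=1..i. a j) - 1"

end

theory Submission
  imports Defs
begin

text \<open>
  Let \<open>M(m)\<close> be the number of rationals in \<open>(0,1]\<close> with digit sum at most \<open>m\<close>, and \<open>N(m,x)\<close> the number
  of those that are at most \<open>x\<close>. Splitting \<open>(0,1]\<close> at \<open>1/3\<close> and \<open>1/2\<close>, the branches \<open>y/(1+2y)\<close>, \<open>1/(3-y)\<close>
  and \<open>1/(1+y)\<close> raise the digit sum by 2, 3 and 1; hence \<open>M\<close> is a tribonacci sequence and
  \<open>M(m-j)/M(m)\<close> tends to \<open>\<lambda>^(-j)\<close>. The same branches show that, up to an error of at most 1,
  \<open>N(m, 1/(a + e y)) = M(m-(a-1)) - e N(m-a, y)\<close>. Iterating this along the expansion of \<open>x\<close> and dividing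
  by \<open>M(m)\<close> gives the partial sums of the series, with a remainder at most \<open>\<lambda>^(-s)\<close> in the
  limit, where \<open>s\<close> is the sum of the digits used.
\<close>

subsection \<open>Digit sums of rationals\<close>

text \<open>
  \<open>ocf_sum x s\<close>: \<open>x\<close> has a finite expansion with digit sum \<open>s\<close>. For \<open>e = -1\<close>, the bound \<open>3 \<le> a\<close>
  is \<open>a + e \<ge> 2\<close>, \<open>0 < y\<close> says that a further digit occurs, and \<open>y < 1\<close> forbids a last
  digit 1 with sign \<open>-1\<close>.
\<close>

inductive ocf_sum :: "real \<Rightarrow> nat \<Rightarrow> bool" where
  zero: "ocf_sum 0 0"
| step: "ocf_sum y s \<Longrightarrow> odd a \<Longrightarrow> e = 1 \<or> e = -1 \<and> 3 \<le> a \<and> 0 < y \<and> y < 1 \<Longrightarrow>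
    ocf_sum (1 / (real a + e * y)) (a + s)"

text \<open>One continued fraction step \<open>1 / (a + e * y)\<close>: the side condition of
  \<open>step\<close> together with the range of the tail. The tail \<open>0\<close> goes only with
  sign \<open>1\<close> and means that the expansion stops here.\<close>

definition admissible :: "nat \<Rightarrow> real \<Rightarrow> real \<Rightarrow> bool" where
  "admissible a e y \<longleftrightarrow> odd a \<and> 0 \<le> y \<and> y \<le> 1 \<and> (e = 1 \<or> e = -1 \<and> 3 \<le> a \<and> 0 < y \<and> y < 1)"

lemma admissible_ge_1: "admissible a e y \<Longrightarrow> 1 \<le> real a + e * y"
proof -
  assume h: "admissible a e y"
  hence "1 \<le> a" unfolding admissible_def by (metis One_nat_def Suc_leI odd_pos)
  hence "1 \<le> real a" by simp
  with h show ?thesis unfolding admissible_def by auto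
qed

lemma ocf_sum_range: "ocf_sum x s \<Longrightarrow> x \<in> \<rat> \<and> 0 \<le> x \<and> x \<le> 1"
proof (induction rule: ocf_sum.induct)
  case (step y s a e)
  hence "admissible a e y" unfolding admissible_def by auto
  from admissible_ge_1[OF this] have "1 \<le> real a + e * y" .
  moreover have "e * y \<in> \<rat>" using step by auto
  ultimately show ?case by auto
qed auto

lemma ocf_sum_cf: "ocf_sum y s \<Longrightarrow> admissible a e y \<Longrightarrow> ocf_sum (1 / (real a + e * y)) (a + s)"
  unfolding admissible_def by (auto intro: ocf_sum.step)

lemma ocf_sum_pos_cases:
  assumes "ocf_sum x s" "0 < x"
  obtains y s' a e where "x = 1 / (real a + e * y)" "s = a + s'" "ocf_sum y s'" "admissible a e y"
  using assms
proof (cases rule: ocf_sum.cases)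
  case (step y s' a e)
  with ocf_sum_range[OF step(3)] show ?thesis
    by (intro that[of a e y s']) (auto simp: admissible_def)
qed auto

lemma ocf_sum_0: "ocf_sum x s \<Longrightarrow> x = 0 \<Longrightarrow> s = 0"
proof (induction rule: ocf_sum.induct)
  case (step y s a e)
  with ocf_sum_range[OF step(1)] have "admissible a e y" by (auto simp: admissible_def)
  from admissible_ge_1[OF this] step.prems show ?case by auto
qed auto

lemma ocf_sum_pos: "ocf_sum x s \<Longrightarrow> 0 < x \<Longrightarrow> 0 < s"
  by (erule (1) ocf_sum_pos_cases) (auto simp: admissible_def odd_pos)

text \<open>For a given \<open>a\<close> the values \<open>a + e * y\<close> lie in
  \<open>(a - 1, a + 1]\<close>, where sign \<open>-1\<close> gives the part below \<open>a\<close>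
  and sign \<open>1\<close> the rest. For distinct odd \<open>a\<close> these intervals are
  disjoint.\<close>

lemma admissible_unique:
  assumes "admissible a e y" "admissible a' e' y'" "real a + e * y = real a' + e' * y'"
  shows "a = a' \<and> y = y'"
proof -
  have aux: False if "admissible a e y" "admissible a' e' y'" "real a + e * y = real a' + e' * y'" "a < a'"
    for a a' e e' y y'
  proof -
    have "odd a" "odd a'" using that by (auto simp: admissible_def)
    hence "a + 2 \<le> a'" using that(4) by presburger
    hence "real a + 2 \<le> real a'" by linarith
    thus False using that unfolding admissible_def by auto
  qed
  have "a = a'" using aux[OF assms] aux[OF assms(2,1) assms(3)[symmetric]] by (meson linorder_neqE_nat)
  thus ?thesis using assms unfolding admissible_def by auto
qed

lemma ocf_sum_unique: "ocf_sum x s \<Longrightarrow> ocf_sum x s' \<Longrightarrow> s = s'"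
proof (induction arbitrary: s' rule: ocf_sum.induct)
  case zero
  then show ?case using ocf_sum_0 by simp
next
  case (step y s a e)
  have ad: "admissible a e y" using step ocf_sum_range[OF step(1)] by (auto simp: admissible_def)
  have pos: "0 < 1 / (real a + e * y)" using admissible_ge_1[OF ad] by auto
  from step(5) pos obtain y' s'' a' e' where *: "1 / (real a + e * y) = 1 / (real a' + e' * y')"
    "s' = a' + s''" "ocf_sum y' s''" "admissible a' e' y'" by (rule ocf_sum_pos_cases)
  from * have "real a + e * y = real a' + e' * y'" by auto
  from admissible_unique[OF ad *(4) this] * step(4)[of s''] show ?case by auto
qed

text \<open>Division with remainder by \<open>2 * p\<close> instead of \<open>p\<close> yields an
  odd integer \<open>a\<close> at distance at most \<open>1\<close> from \<open>q / p\<close>; the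
  sign says on which side of \<open>a\<close> the quotient lies.\<close>

lemma rational_admissible_step:
  fixes p q :: nat
  assumes "0 < p" "p \<le> q"
  obtains a r e where "admissible a e (real r / real p)" "real q / real p = real a + e * (real r / real p)"
proof -
  define k where "k = q div (2 * p)"
  define r where "r = q mod (2 * p)"
  have q: "q = 2 * p * k + r" unfolding k_def r_def by simp
  have r: "r < 2 * p" unfolding r_def using assms by simp
  have rq: "real q = 2 * real p * real k + real r" using q by simp
  consider "p \<le> r" | "r = 0" | "0 < r" "r < p" by linarith
  thus ?thesis
  proof cases
    case 1
    show ?thesis
      by (rule that[of "2 * k + 1" 1 "r - p"])
        (use 1 r rq assms in \<open>auto simp: admissible_def field_simps of_nat_diff\<close>)
  next
    case 2
    \<comment> \<open>An even quotient \<open>q / p = 2 * k\<close> is read as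
      \<open>(2 * k - 1) + 1\<close> with tail \<open>1\<close>, since sign \<open>-1\<close> would
      require a tail below \<open>1\<close>.\<close>
    then obtain k' where k': "k = Suc k'" using q assms by (cases k) auto
    show ?thesis
      by (rule that[of "2 * k' + 1" 1 p])
        (use 2 k' rq assms in \<open>auto simp: admissible_def field_simps\<close>)
  next
    case 3
    \<comment> \<open>Here \<open>r < p <= q\<close> forces \<open>k > 0\<close>, so the digit
      \<open>2 * k + 1\<close> is at least \<open>3\<close>, as sign \<open>-1\<close>
      demands.\<close>
    then obtain k' where k': "k = Suc k'" using q assms by (cases k) auto
    show ?thesis
      by (rule that[of "2 * k + 1" "-1" "p - r"])
        (use 3 k' rq assms in \<open>auto simp: admissible_def field_simps of_nat_diff\<close>)
  qed
qed

text \<open>Euclidean descent: the tail \<open>r / p\<close> has numerator \<open>r <= p\<close>,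
  and the numerator drops strictly unless the tail is \<open>1\<close>.\<close>

lemma ocf_sum_exists_frac:
  fixes p q :: nat
  shows "p \<le> q \<Longrightarrow> 0 < q \<Longrightarrow> \<exists>s. ocf_sum (real p / real q) s"
proof (induction p arbitrary: q rule: less_induct)
  case (less p)
  show ?case
  proof (cases "p = 0")
    case True
    thus ?thesis using ocf_sum.zero by auto
  next
    case False
    then obtain a r e where ad: "admissible a e (real r / real p)"
      and eq: "real q / real p = real a + e * (real r / real p)"
      using rational_admissible_step[of p q] less.prems by blast
    have "r \<le> p" using ad False by (auto simp: admissible_def field_simps)
    have "\<exists>s. ocf_sum (real r / real p) s"
    proof (cases "r = p")
      case True
      \<comment> \<open>The tail \<open>1\<close>, where the descent stalls, is the single digit
        \<open>1\<close>.\<close>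
      have "ocf_sum (1 / (real 1 + 1 * 0)) (1 + 0)"
        by (rule ocf_sum.step) (auto intro: ocf_sum.zero)
      thus ?thesis using True False by auto
    next
      case r: False
      thus ?thesis using less.IH[of r p] \<open>r \<le> p\<close> False by auto
    qed
    then obtain s where "ocf_sum (real r / real p) s" ..
    from ocf_sum_cf[OF this ad] have "ocf_sum (1 / (real q / real p)) (a + s)" unfolding eq .
    thus ?thesis by auto
  qed
qed

lemma ocf_sum_exists:
  assumes "x \<in> \<rat>" "0 \<le> x" "x \<le> 1"
  shows "\<exists>s. ocf_sum x s"
proof -
  obtain m n :: nat where "n \<noteq> 0" "\<bar>x\<bar> = real m / real n"
    using Rats_abs_nat_div_natE[OF assms(1)] by metis
  hence x: "x = real m / real n" "0 < n" using assms by auto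
  hence "m \<le> n" using assms(3) by (simp add: divide_le_eq)
  with ocf_sum_exists_frac[of m n] x show ?thesis by simp
qed

section \<open>Agreement of \<open>ocf_sum\<close> with the odd continued fraction
  expansions\<close>

lemma cf_frac_cong:
  "(\<And>i. k \<le> i \<Longrightarrow> i < k + m \<Longrightarrow> eps i = eps' i \<and> a i = a' i) \<Longrightarrow> cf_frac m eps a k = cf_frac m eps' a' k"
proof (induction m arbitrary: k)
  case (Suc m)
  have "cf_frac m eps a (Suc k) = cf_frac m eps' a' (Suc k)" by (rule Suc.IH) (use Suc.prems in auto)
  thus ?case using Suc.prems[of k] by simp
qed simp

lemma cf_frac_shift:
  "cf_frac m (\<lambda>i. eps (i - 1)) (\<lambda>i. a (i - 1)) (Suc k) = cf_frac m eps a k"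
  by (induction m arbitrary: k) simp_all

lemma odd_cf_digits_enatD:
  assumes "odd_cf_digits (enat l) eps a"
  shows "1 \<le> i \<Longrightarrow> i \<le> l \<Longrightarrow> odd (a i) \<and> eps i \<in> {1, -1}"
    and "1 \<le> l \<Longrightarrow> eps 1 = 1"
    and "1 \<le> i \<Longrightarrow> Suc i \<le> l \<Longrightarrow> 2 \<le> int (a i) + eps (Suc i)"
    and "1 \<le> l \<Longrightarrow> a l = 1 \<Longrightarrow> eps l = 1"
proof -
  show "1 \<le> i \<Longrightarrow> i \<le> l \<Longrightarrow> odd (a i) \<and> eps i \<in> {1, -1}"
    using assms unfolding odd_cf_digits_def by (metis enat_ord_simps(1))
qed (use assms in \<open>auto simp: odd_cf_digits_def one_enat_def\<close>)

text \<open>Each \<open>step\<close> prepends a digit. The sign \<open>e\<close> in front of the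
  tail becomes the second sign, replacing the old leading sign, which was \<open>1\<close>.\<close>

lemma odd_cf_expansion_if_ocf_sum:
  "ocf_sum x s \<Longrightarrow> \<exists>l eps a. odd_cf_expansion x (enat l) eps a \<and> s = (\<Sum>j=1..l. a j)"
proof (induction rule: ocf_sum.induct)
  case zero
  show ?case
    by (intro exI[of _ 0] exI[of _ "\<lambda>_. 1"]) (auto simp: odd_cf_expansion_def odd_cf_digits_def one_enat_def)
next
  case (step y s a e)
  then obtain l eps b where exp: "odd_cf_expansion y (enat l) eps b" and s: "s = (\<Sum>j=1..l. b j)" by auto
  have y: "y = cf_frac l eps b 1" and dig: "odd_cf_digits (enat l) eps b"
    using exp by (auto simp: odd_cf_expansion_def)
  define e' :: int where "e' = (if e = 1 then 1 else -1)"
  have e': "e = of_int e'" "e' = 1 \<or> e' = -1" "e' = -1 \<Longrightarrow> 3 \<le> a \<and> 0 < y \<and> y < 1"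
    using step by (auto simp: e'_def)
  define eps' where "eps' i = (if i = 1 then 1 else if i = 2 then e' else eps (i - 1))" for i :: nat
  define a' where "a' i = (if i = 1 then a else b (i - 1))" for i :: nat
  note d1 = odd_cf_digits_enatD(1)[OF dig] and d2 = odd_cf_digits_enatD(2)[OF dig]
    and d3 = odd_cf_digits_enatD(3)[OF dig] and d4 = odd_cf_digits_enatD(4)[OF dig]
  \<comment> \<open>Since the old leading sign is \<open>1\<close>, overwriting it by
    \<open>e'\<close> multiplies the fraction by \<open>e'\<close>; for \<open>l = 0\<close> both
    sides are \<open>0\<close>.\<close>
  have tail: "cf_frac l eps' a' 2 = of_int e' * y"
  proof (cases l)
    case 0
    thus ?thesis using y by simp
  next
    case (Suc n)
    have "cf_frac n eps' a' (Suc (Suc 1)) = cf_frac n (\<lambda>i. eps (i - 1)) (\<lambda>i. b (i - 1)) (Suc (Suc 1))"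
      by (rule cf_frac_cong) (auto simp: eps'_def a'_def)
    also have "\<dots> = cf_frac n eps b (Suc 1)" by (rule cf_frac_shift)
    finally show ?thesis using y d2 Suc
      by (simp add: numeral_2_eq_2) (simp add: eps'_def a'_def)
  qed
  have x: "1 / (real a + e * y) = cf_frac (Suc l) eps' a' 1"
    using tail e' by (simp add: numeral_2_eq_2) (simp add: eps'_def a'_def)
  have "odd_cf_digits (enat (Suc l)) eps' a'"
    unfolding odd_cf_digits_def
  proof (intro conjI allI impI)
    fix i assume i: "1 \<le> i" "enat i \<le> enat (Suc l)"
    show "odd (a' i)" "eps' i \<in> {1,-1}"
      using i d1[of "i - 1"] step(2) e' by (auto simp: a'_def eps'_def)
  next
    show "eps' 1 = 1" by (simp add: eps'_def)
  next
    fix j assume j: "1 \<le> j" "enat (Suc j) \<le> enat (Suc l)"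
    have "a \<ge> 1" using step(2) by (cases a) auto
    thus "2 \<le> int (a' j) + eps' (Suc j)"
      using j e' d1[of "j - 1"] d3[of "j - 1"] by (cases "j = 1") (auto simp: a'_def eps'_def)
  next
    fix l' assume l': "1 \<le> l'" "enat (Suc l) = enat l'" "a' l' = 1"
    show "eps' l' = 1"
    proof (cases "l' = 2")
      case False
      thus ?thesis using l' d4 by (auto simp: a'_def eps'_def split: if_splits)
    next
      \<comment> \<open>The last digit is then the only digit of \<open>y\<close>; being
        \<open>1\<close>, it makes \<open>y = 1\<close>, which excludes sign
        \<open>-1\<close>.\<close>
      case True
      hence "l = 1" "b 1 = 1" using l' by (auto simp: a'_def)
      hence "y = 1" using y d2 by auto
      thus ?thesis using e' True by (auto simp: eps'_def)
    qed
  qed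
  hence "odd_cf_expansion (1 / (real a + e * y)) (enat (Suc l)) eps' a'"
    using x by (simp add: odd_cf_expansion_def)
  moreover have "a + s = (\<Sum>j=1..Suc l. a' j)"
  proof -
    have "(\<Sum>j=1..Suc l. a' j) = a' 1 + (\<Sum>j=Suc 1..Suc l. a' j)"
      by (simp add: sum.atLeast_Suc_atMost)
    also have "(\<Sum>j=Suc 1..Suc l. a' j) = (\<Sum>j=1..l. a' (Suc j))"
      by (rule sum.shift_bounds_cl_Suc_ivl)
    finally show ?thesis using s by (simp add: a'_def)
  qed
  ultimately show ?case by blast
qed

lemma ocf_sum_if_odd_cf_expansion:
  assumes "odd_cf_expansion x (enat l) eps a"
  shows "ocf_sum x (\<Sum>j=1..l. a j)"
proof -
  have x: "x = cf_frac l eps a 1" and dig: "odd_cf_digits (enat l) eps a"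
    using assms by (auto simp: odd_cf_expansion_def)
  note d1 = odd_cf_digits_enatD(1)[OF dig] and d2 = odd_cf_digits_enatD(2)[OF dig]
    and d3 = odd_cf_digits_enatD(3)[OF dig] and d4 = odd_cf_digits_enatD(4)[OF dig]
  \<comment> \<open>Induction on the number \<open>k\<close> of remaining levels, where
    \<open>y\<close> is the tail from index \<open>j\<close> without its sign. The last two
    conjuncts supply \<open>0 < y\<close> and \<open>y < 1\<close>, which \<open>admissible\<close>
    asks for under sign \<open>-1\<close>.\<close>
  have main: "\<exists>y. ocf_sum y (\<Sum>i=j..l. a i) \<and> cf_frac k eps a j = of_int (eps j) * y \<and> (k > 0 \<longrightarrow> y > 0)
      \<and> (y = 1 \<longrightarrow> k = 1 \<and> a l = 1)" if "j \<ge> 1" "j + k = Suc l" for k j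
    using that
  proof (induction k arbitrary: j)
    case 0
    thus ?case using ocf_sum.zero by auto
  next
    case (Suc k)
    from Suc.IH[of "Suc j"] Suc.prems obtain y where y: "ocf_sum y (\<Sum>i=Suc j..l. a i)"
      "cf_frac k eps a (Suc j) = of_int (eps (Suc j)) * y" "k > 0 \<longrightarrow> y > 0" "y = 1 \<longrightarrow> k = 1 \<and> a l = 1" by auto
    \<comment> \<open>For \<open>k = 0\<close> the index \<open>Suc j\<close> lies beyond the
      expansion and \<open>eps\<close> is arbitrary there; the default sign \<open>1\<close> is
      harmless because \<open>y = 0\<close>.\<close>
    define e :: real where "e = (if k = 0 then 1 else of_int (eps (Suc j)))"
    have k0: "k = 0 \<Longrightarrow> y = 0" using y(1) Suc.prems by (cases rule: ocf_sum.cases[OF y(1)]) (use Suc.prems in \<open>auto\<close>)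
    have ey: "of_int (eps (Suc j)) * y = e * y" using k0 by (auto simp: e_def)
    have ad: "admissible (a j) e y"
    proof (cases "e = 1")
      case True
      thus ?thesis using ocf_sum_range[OF y(1)] d1[of j] Suc.prems by (auto simp: admissible_def)
    next
      case False
      hence k: "k > 0" by (auto simp: e_def split: if_splits)
      have m: "eps (Suc j) = -1" using False d1[of "Suc j"] Suc.prems k by (auto simp: e_def)
      have "3 \<le> a j" using d3[of j] m Suc.prems k by auto
      \<comment> \<open>If \<open>y = 1\<close>, a final digit \<open>1\<close> would follow the
        sign \<open>-1\<close>, which the last digit condition forbids.\<close>
      moreover have "y \<noteq> 1" using y(4) d4 m Suc.prems k by force
      ultimately show ?thesis using m k y(3) ocf_sum_range[OF y(1)] d1[of j] Suc.prems
        by (auto simp: admissible_def e_def)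
    qed
    have "ocf_sum (1 / (real (a j) + e * y)) (a j + (\<Sum>i=Suc j..l. a i))" by (rule ocf_sum_cf[OF y(1) ad])
    moreover have "a j + (\<Sum>i=Suc j..l. a i) = (\<Sum>i=j..l. a i)"
      using Suc.prems by (simp add: sum.atLeast_Suc_atMost)
    moreover have "cf_frac (Suc k) eps a j = of_int (eps j) * (1 / (real (a j) + e * y))"
      using y(2) ey by simp
    moreover have "0 < 1 / (real (a j) + e * y)" using admissible_ge_1[OF ad] by auto
    moreover have "Suc k = 1 \<and> a l = 1" if "1 / (real (a j) + e * y) = 1"
    proof -
      have eq: "real (a j) + e * y = 1" using that by (simp add: divide_eq_eq split: if_splits)
      have a1: "1 \<le> real (a j)" using d1[of j] Suc.prems by (cases "a j") auto
      \<comment> \<open>Sign \<open>-1\<close> would make the denominator exceed \<open>2\<close>;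
        so the sign is \<open>1\<close> and \<open>y\<close> must vanish.\<close>
      have "y = 0" using ad eq a1 unfolding admissible_def by auto
      hence "k = 0" using y(3) by auto
      thus ?thesis using eq \<open>y = 0\<close> Suc.prems by auto
    qed
    ultimately show ?case by metis
  qed
  from main[of 1 l] obtain y where "ocf_sum y (\<Sum>i=1..l. a i)" "x = of_int (eps 1) * y" "l = 0 \<Longrightarrow> x = 0" using x by auto
  moreover have "eps 1 = 1 \<or> l = 0" using d2 by linarith
  ultimately show ?thesis using ocf_sum.zero by auto
qed

lemma S0_eq: "ocf_sum x s \<Longrightarrow> S0 x = s"
  unfolding S0_def
proof (rule the_equality)
  assume "ocf_sum x s"
  thus "\<exists>l eps a. odd_cf_expansion x (enat l) eps a \<and> s = (\<Sum>j=1..l. a j)"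
    by (rule odd_cf_expansion_if_ocf_sum)
  show "s' = s" if "\<exists>l eps a. odd_cf_expansion x (enat l) eps a \<and> s' = (\<Sum>j=1..l. a j)" for s'
    using that ocf_sum_if_odd_cf_expansion ocf_sum_unique[OF \<open>ocf_sum x s\<close>] by blast
qed

subsection \<open>Counting rationals by digit sum\<close>

text \<open>Since \<open>T 0\<close> is empty, truncated subtraction in the argument of \<open>T\<close> is harmless below.\<close>

definition T :: "nat \<Rightarrow> real set" where
  "T m = {\<xi>. 0 < \<xi> \<and> (\<exists>s\<le>m. ocf_sum \<xi> s)}"

lemma Y_set_eq: "Y_set n = insert 0 (T (n + 1))"
proof -
  have "x \<in> Y_set n \<longleftrightarrow> x \<in> insert 0 (T (n + 1))" for x
  proof (cases "x \<in> \<rat> \<and> 0 \<le> x \<and> x \<le> 1")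
    case True
    then obtain s where s: "ocf_sum x s" using ocf_sum_exists[of x] by auto
    have "(\<exists>t\<le>n + 1. ocf_sum x t) \<longleftrightarrow> s \<le> n + 1"
      using s ocf_sum_unique[OF s] by blast
    thus ?thesis
      using True S0_eq[OF s] ocf_sum_0[OF s] by (auto simp: Y_set_def T_def)
  next
    case False
    thus ?thesis using ocf_sum_range by (auto simp: Y_set_def T_def)
  qed
  thus ?thesis by blast
qed

lemma T_range: "y \<in> T m \<Longrightarrow> 0 < y \<and> y \<le> 1"
  using ocf_sum_range by (auto simp: T_def)

lemma T_0: "T 0 = {}"
  using ocf_sum_pos by (fastforce simp: T_def)

lemma T_cfI:
  assumes "ocf_sum y s" "admissible a e y" "a + s \<le> m"
  shows "1 / (real a + e * y) \<in> T m"
  using assms ocf_sum_cf[OF assms(1,2)] admissible_ge_1[OF assms(2)] by (auto simp: T_def)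

text \<open>Cases on the first digit: \<open>a = 1\<close> gives the first branch. Lowering
  \<open>a\<close> by \<open>2\<close> turns \<open>1 / x\<close> into \<open>1 / x - 2\<close> and
  gives the second, except for \<open>a = 3\<close> with sign \<open>-1\<close>, where the lowered
  digit would be inadmissible; that case is the third. There \<open>y = 1\<close> is left out: its
  image \<open>1 / 2\<close> already comes from the first branch.\<close>

lemma T_decomp:
  "T (Suc m) = (\<lambda>y. 1 / (1 + y)) ` insert 0 (T m) \<union> (\<lambda>y. y / (1 + 2 * y)) ` T (m - 1)
     \<union> (\<lambda>y. 1 / (3 - y)) ` (T (m - 2) - {1})" (is "_ = ?A \<union> ?B \<union> ?C")
proof (intro equalityI subsetI)
  fix x assume x: "x \<in> T (Suc m)"
  then obtain s where s: "s \<le> Suc m" "ocf_sum x s" "0 < x" by (auto simp: T_def)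
  from s(2,3) obtain y s' a e where *: "x = 1 / (real a + e * y)" "s = a + s'" "ocf_sum y s'" "admissible a e y"
    by (rule ocf_sum_pos_cases)
  have yT: "y \<in> insert 0 (T k)" if "s' \<le> k" for k
    using that *(3) ocf_sum_range[OF *(3)] by (auto simp: T_def)
  consider "a = 1" | "a = 3" "e = -1" | "a \<ge> 3" "\<not> (a = 3 \<and> e = -1)"
  proof -
    have "odd a" using *(4) by (auto simp: admissible_def)
    hence "a = 1 \<or> a \<ge> 3" by presburger
    thus ?thesis using that by blast
  qed
  thus "x \<in> ?A \<union> ?B \<union> ?C"
  proof cases
    case 1
    hence "x = 1 / (1 + y)" using * by (auto simp: admissible_def)
    moreover have "s' \<le> m" using 1 * s by simp
    ultimately show ?thesis using yT[of m] by blast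
  next
    case 2
    hence "x = 1 / (3 - y)" "y \<in> T (m - 2)" "y \<noteq> 1" using yT[of "m - 2"] * s by (auto simp: admissible_def)
    thus ?thesis by blast
  next
    case 3
    have ad: "admissible (a - 2) e y" using 3 *(4) by (auto simp: admissible_def elim!: oddE)
    define z where "z = 1 / (real (a - 2) + e * y)"
    have ge: "1 \<le> real (a - 2) + e * y" by (rule admissible_ge_1[OF ad])
    have "z \<in> T (m - 1)" unfolding z_def by (rule T_cfI[OF *(3) ad]) (use * s 3 in auto)
    moreover have "x = z / (1 + 2 * z)"
    proof -
      have "real (a - 2) = real a - 2" using 3 by auto
      thus ?thesis using ge *(1) unfolding z_def by (auto simp: field_simps)
    qed
    ultimately show ?thesis by blast
  qed
next
  fix x assume "x \<in> ?A \<union> ?B \<union> ?C"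
  then consider "x \<in> ?A" | "x \<in> ?B" | "x \<in> ?C" by blast
  thus "x \<in> T (Suc m)"
  proof cases
    case 1
    then obtain y where y: "x = 1 / (1 + y)" "y \<in> insert 0 (T m)" by blast
    then obtain s where "s \<le> m" "ocf_sum y s" using ocf_sum.zero by (auto simp: T_def)
    with T_cfI[of y s 1 1 "Suc m"] ocf_sum_range[of y s] show ?thesis
      by (auto simp: y(1) admissible_def)
  next
    case 2
    then obtain z s where z: "x = z / (1 + 2 * z)" "ocf_sum z s" "s \<le> m - 1" "0 < z" by (auto simp: T_def)
    from z(2,4) obtain y s' a e where *: "z = 1 / (real a + e * y)" "s = a + s'" "ocf_sum y s'" "admissible a e y"
      by (rule ocf_sum_pos_cases)
    \<comment> \<open>With \<open>s <= m - 1\<close> this forces \<open>m >= 2\<close>, so the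
      subtraction is exact and the sum \<open>s + 2\<close> is at most \<open>Suc m\<close>.\<close>
    have "0 < s" using ocf_sum_pos z by auto
    have "1 / (real (a + 2) + e * y) \<in> T (Suc m)"
      by (rule T_cfI[OF *(3)]) (use * z \<open>0 < s\<close> in \<open>auto simp: admissible_def\<close>)
    moreover have "x = 1 / (real (a + 2) + e * y)"
      using admissible_ge_1[OF *(4)] by (auto simp: z *(1) field_simps)
    ultimately show ?thesis by simp
  next
    case 3
    then obtain y s where y: "x = 1 / (3 - y)" "ocf_sum y s" "s \<le> m - 2" "0 < y" "y \<noteq> 1" by (auto simp: T_def)
    have "0 < s" using ocf_sum_pos y by auto
    with T_cfI[of y s 3 "-1" "Suc m"] ocf_sum_range[OF y(2)] y show ?thesis
      by (auto simp: admissible_def)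
  qed
qed

lemma finite_T: "finite (T m)"
proof (induction m rule: less_induct)
  case (less m)
  show ?case
  proof (cases m)
    case 0
    thus ?thesis by (simp add: T_0)
  next
    case (Suc k)
    have "finite (T k)" "finite (T (k - 1))" "finite (T (k - 2))" using less Suc by auto
    thus ?thesis unfolding Suc T_decomp by auto
  qed
qed

lemma inj_branches:
  "inj_on (\<lambda>y::real. 1 / (1 + y)) {0..1}"
  "inj_on (\<lambda>y::real. y / (1 + 2 * y)) {0..1}"
  "inj_on (\<lambda>y::real. 1 / (3 - y)) {0..1}"
  by (auto simp: inj_on_def field_simps)

text \<open>The branches map \<open>[0,1]\<close> into \<open>[1/2,1]\<close>,
  \<open>[0,1/3]\<close> and \<open>[1/3,1/2]\<close>, which meet only at endpoints; the strict
  versions exclude the endpoints and make the images of the sets \<open>T\<close> disjoint.\<close>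

lemma branch_bounds:
  fixes y :: real
  assumes "0 \<le> y" "y \<le> 1"
  shows "1 / 2 \<le> 1 / (1 + y)" "y / (1 + 2 * y) \<le> 1 / 3" "1 / 3 \<le> 1 / (3 - y)"
    "0 < y \<Longrightarrow> 1 / 3 < 1 / (3 - y)" "1 / (3 - y) \<le> 1 / 2" "y < 1 \<Longrightarrow> 1 / (3 - y) < 1 / 2"
  using assms by (auto simp: field_simps)

section \<open>Counting functions and their behaviour under the three branches\<close>

definition N :: "nat \<Rightarrow> real \<Rightarrow> nat" where
  "N m x = card {\<xi> \<in> T m. \<xi> \<le> x}"

abbreviation M :: "nat \<Rightarrow> nat" where
  "M m \<equiv> card (T m)"

lemma N_0: "N m 0 = 0"
  using T_range by (fastforce simp: N_def card_eq_0_iff)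

lemma N_at_0: "N 0 x = 0"
  by (simp add: N_def T_0)

lemma N_le_M: "N m x \<le> M m"
  unfolding N_def by (intro card_mono finite_T) auto

lemma card_branch_images:
  assumes "A \<subseteq> {0..1::real}"
  shows "card ((\<lambda>y. 1 / (1 + y)) ` A) = card A" "card ((\<lambda>y. y / (1 + 2 * y)) ` A) = card A"
    "card ((\<lambda>y. 1 / (3 - y)) ` A) = card A"
  by (intro card_image inj_on_subset[OF inj_branches(1) assms] inj_on_subset[OF inj_branches(2) assms]
      inj_on_subset[OF inj_branches(3) assms])+

lemma T_subset: "T m \<subseteq> {0..1}"
  using T_range by force

lemma T_branch_bounds:
  "y \<in> insert 0 (T m) \<Longrightarrow> 1 / 2 \<le> 1 / (1 + y)"
  "y \<in> T m \<Longrightarrow> y / (1 + 2 * y) \<le> 1 / 3"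
  "y \<in> T m \<Longrightarrow> 1 / 3 < 1 / (3 - y)"
  "y \<in> T m \<Longrightarrow> 1 / (3 - y) \<le> 1 / 2"
  "y \<in> T m - {1} \<Longrightarrow> 1 / (3 - y) < 1 / 2"
  using T_range[of y m] branch_bounds[of y] by auto

text \<open>The three parts of \<open>T_decomp\<close> are disjoint images under injective maps. The
  extra \<open>1\<close> counts the image of \<open>y = 0\<close>.\<close>

lemma M_Suc: "M (Suc m) = (M m + 1) + M (m - 1) + card (T (m - 2) - {1})"
proof -
  let ?f = "\<lambda>y::real. 1 / (1 + y)" and ?g = "\<lambda>y::real. y / (1 + 2 * y)" and ?h = "\<lambda>y::real. 1 / (3 - y)"
  have 1: "?f ` insert 0 (T m) \<inter> ?g ` T (m - 1) = {}"
  proof -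
    have "?f y \<noteq> ?g z" if "y \<in> insert 0 (T m)" "z \<in> T (m - 1)" for y z
      using T_branch_bounds(1)[OF that(1)] T_branch_bounds(2)[OF that(2)] by linarith
    thus ?thesis by blast
  qed
  have 2: "(?f ` insert 0 (T m) \<union> ?g ` T (m - 1)) \<inter> ?h ` (T (m - 2) - {1}) = {}"
  proof -
    have "?f y \<noteq> ?h z" if "y \<in> insert 0 (T m)" "z \<in> T (m - 2) - {1}" for y z
      using T_branch_bounds(1)[OF that(1)] T_branch_bounds(5)[OF that(2)] by linarith
    moreover have "?g y \<noteq> ?h z" if "y \<in> T (m - 1)" "z \<in> T (m - 2) - {1}" for y z
      using T_branch_bounds(2)[OF that(1)] T_branch_bounds(3)[of z "m - 2"] that(2) by force
    ultimately show ?thesis by blast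
  qed
  have "0 \<notin> T m" using T_range[of 0] by auto
  hence "card (?f ` insert 0 (T m)) = M m + 1"
    using T_subset by (subst card_branch_images) (auto simp: finite_T)
  moreover have "card (?g ` T (m - 1)) = M (m - 1)"
    using T_subset by (rule card_branch_images)
  moreover have "card (?h ` (T (m - 2) - {1})) = card (T (m - 2) - {1})"
    using T_subset by (intro card_branch_images) blast
  moreover have "M (Suc m) = card (?f ` insert 0 (T m) \<union> ?g ` T (m - 1)) + card (?h ` (T (m - 2) - {1}))"
    unfolding T_decomp by (rule card_Un_disjoint[OF _ _ 2]) (auto simp: finite_T)
  moreover have "card (?f ` insert 0 (T m) \<union> ?g ` T (m - 1)) = card (?f ` insert 0 (T m)) + card (?g ` T (m - 1))"
    by (rule card_Un_disjoint[OF _ _ 1]) (auto simp: finite_T)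
  ultimately show ?thesis by linarith
qed

text \<open>The point \<open>1\<close> removed in the third branch cancels the extra
  \<open>1\<close> of the first branch. This takes \<open>1\<close> to be in \<open>T m\<close>,
  hence \<open>m >= 1\<close>.\<close>

lemma M_tribonacci: "m \<ge> 1 \<Longrightarrow> M (m + 3) = M (m + 2) + M (m + 1) + M m"
proof -
  assume "m \<ge> 1"
  have "ocf_sum (1 / (real 1 + 1 * 0)) (1 + 0)"
    by (rule ocf_sum.step) (auto intro: ocf_sum.zero)
  hence "1 \<in> T m" using \<open>m \<ge> 1\<close> by (auto simp: T_def)
  hence "M m = Suc (card (T m - {1}))" by (metis card.remove finite_T)
  thus ?thesis using M_Suc[of "m + 2"] by (simp add: eval_nat_numeral)
qed

text \<open>Linear growth gives positive denominators and \<open>M m\<close> tending to infinity,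
  which makes bounded counting errors negligible.\<close>

lemma M_ge: "m \<le> M m"
proof (induction m)
  case (Suc m)
  thus ?case using M_Suc[of m] by simp
qed simp

text \<open>Points of \<open>T m\<close> up to \<open>x / (1 + 2 * x) <= 1/3\<close> can come only
  from the second branch, which is increasing; hence the count is exact.\<close>

lemma N_shift:
  assumes "0 \<le> x" "x \<le> 1"
  shows "N m (x / (1 + 2 * x)) = N (m - 2) x"
proof (cases m)
  case 0
  thus ?thesis by (simp add: N_at_0)
next
  case (Suc k)
  let ?g = "\<lambda>y::real. y / (1 + 2 * y)"
  have le: "?g y \<le> ?g x \<longleftrightarrow> y \<le> x" if "0 \<le> y" for y
    using that assms by (auto simp: field_simps)
  have "{\<xi> \<in> T m. \<xi> \<le> ?g x} = ?g ` {\<xi> \<in> T (m - 2). \<xi> \<le> x}" (is "?L = ?R")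
  proof (intro equalityI subsetI)
    fix \<xi> assume xi: "\<xi> \<in> ?L"
    hence "\<xi> \<le> ?g x" by blast
    hence "\<xi> \<le> 1 / 3" using branch_bounds(2)[OF assms] by linarith
    moreover have "1 / 2 \<le> 1 / (1 + y)" if "y \<in> insert 0 (T k)" for y
      using T_branch_bounds(1)[OF that] .
    moreover have "1 / 3 < 1 / (3 - y)" if "y \<in> T (k - 2)" for y
      using T_branch_bounds(3)[OF that] .
    ultimately have "\<xi> \<in> ?g ` T (k - 1)" using xi unfolding Suc T_decomp by fastforce
    thus "\<xi> \<in> ?R" using xi le T_range Suc by force
  next
    fix \<xi> assume "\<xi> \<in> ?R"
    then obtain y where y: "y \<in> T (k - 1)" "y \<le> x" "\<xi> = ?g y" using Suc by auto
    thus "\<xi> \<in> ?L" using le[of y] T_range[OF y(1)] unfolding Suc T_decomp by auto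
  qed
  hence "N m (?g x) = card (?g ` {\<xi> \<in> T (m - 2). \<xi> \<le> x})" by (simp add: N_def)
  also have "\<dots> = N (m - 2) x" unfolding N_def using T_subset by (intro card_branch_images) blast
  finally show ?thesis .
qed

text \<open>The first branch is decreasing, so the points above \<open>1 / (1 + x)\<close>
  correspond to \<open>y < x\<close>. Against the count of \<open>y <= x\<close> in
  \<open>T (m - 1)\<close>, this set may gain \<open>0\<close> and may lose \<open>x\<close>, an
  error of at most 1 either way.\<close>

lemma N_branch_plus:
  assumes "0 \<le> x" "x \<le> 1"
  shows "\<bar>real (N m (1 / (1 + x))) - (real (M m) - real (N (m - 1) x))\<bar> \<le> 1"
proof (cases m)
  case 0
  thus ?thesis by (simp add: N_at_0 T_0)
next
  case (Suc k)
  let ?f = "\<lambda>y::real. 1 / (1 + y)"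
  let ?B = "{y \<in> insert 0 (T k). y < x}" and ?A = "{y \<in> T k. y \<le> x}"
  have lt: "?f x < ?f y \<longleftrightarrow> y < x" if "0 \<le> y" for y
    using that assms by (auto simp: field_simps)
  have L: "{\<xi> \<in> T m. \<xi> > ?f x} = ?f ` ?B" (is "?L = ?R")
  proof (intro equalityI subsetI)
    fix \<xi> assume xi: "\<xi> \<in> ?L"
    hence "\<xi> > 1 / 2" using branch_bounds(1)[OF assms] by auto
    moreover have "y / (1 + 2 * y) \<le> 1 / 3" if "y \<in> T (k - 1)" for y
      using T_branch_bounds(2)[OF that] .
    moreover have "1 / (3 - y) \<le> 1 / 2" if "y \<in> T (k - 2)" for y
      using T_branch_bounds(4)[OF that] .
    ultimately have "\<xi> \<in> ?f ` insert 0 (T k)" using xi unfolding Suc T_decomp by fastforce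
    then obtain y where y: "y \<in> insert 0 (T k)" "\<xi> = ?f y" by blast
    have "0 \<le> y" using y(1) T_range[of y k] by auto
    from lt[OF this] y xi show "\<xi> \<in> ?R" by auto
  next
    fix \<xi> assume "\<xi> \<in> ?R"
    then obtain y where y: "y \<in> insert 0 (T k)" "y < x" "\<xi> = ?f y" by blast
    have "0 \<le> y" using y(1) T_range[of y k] by auto
    from lt[OF this] y show "\<xi> \<in> ?L" unfolding Suc T_decomp by auto
  qed
  have "card ?L = card ?B"
    unfolding L using T_subset by (intro card_branch_images) auto
  moreover have "M m = N m (?f x) + card {\<xi> \<in> T m. \<xi> > ?f x}"
  proof -
    have "T m = {\<xi> \<in> T m. \<xi> \<le> ?f x} \<union> {\<xi> \<in> T m. \<xi> > ?f x}" by auto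
    moreover have "card \<dots> = N m (?f x) + card {\<xi> \<in> T m. \<xi> > ?f x}"
      unfolding N_def by (intro card_Un_disjoint) (auto simp: finite_T)
    ultimately show ?thesis by simp
  qed
  moreover have "card ?B \<le> card ?A + 1"
  proof -
    have "card ?B \<le> card (insert 0 ?A)" by (intro card_mono) (auto simp: finite_T)
    also have "\<dots> \<le> card ?A + 1" by (simp add: card_insert_if finite_T)
    finally show ?thesis .
  qed
  moreover have "card ?A \<le> card ?B + 1"
  proof -
    have "card ?A \<le> card (insert x ?B)" by (intro card_mono) (auto simp: finite_T)
    also have "\<dots> \<le> card ?B + 1" by (simp add: card_insert_if finite_T)
    finally show ?thesis .
  qed
  moreover have "card ?A = N (m - 1) x" by (simp add: N_def Suc)
  ultimately show ?thesis by linarith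
qed

text \<open>Below \<open>1 / (3 - x)\<close> lie the whole second branch and the part
  \<open>y <= x\<close> of the third. The point \<open>1/2\<close> may be added and the parameter
  \<open>1\<close> may be missing; these errors have opposite signs, so the bound is 1 and not
  2.\<close>

lemma N_branch_minus:
  assumes "0 \<le> x" "x \<le> 1"
  shows "\<bar>real (N m (1 / (3 - x))) - (real (M (m - 2)) + real (N (m - 3) x))\<bar> \<le> 1"
proof (cases m)
  case 0
  thus ?thesis by (simp add: N_at_0 T_0)
next
  case (Suc k)
  let ?g = "\<lambda>y::real. y / (1 + 2 * y)" and ?h = "\<lambda>y::real. 1 / (3 - y)"
  let ?A = "{y \<in> T (k - 2). y \<le> x}"
  let ?D = "?g ` T (k - 1) \<union> ?h ` (?A - {1})"
  let ?C = "{\<xi> \<in> T m. \<xi> \<le> ?h x}"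
  have le: "?h y \<le> ?h x \<longleftrightarrow> y \<le> x" if "y \<le> 1" for y
    using that assms by (auto simp: field_simps)
  have sub1: "?D \<subseteq> ?C"
  proof
    fix \<xi> assume "\<xi> \<in> ?D"
    moreover have "?g y \<le> ?h x" if "y \<in> T (k - 1)" for y
      using T_branch_bounds(2)[OF that] branch_bounds(3)[OF assms] by linarith
    moreover have "?h y \<le> ?h x" if "y \<in> ?A" for y
      using that le[of y] T_range[of y "k-2"] by auto
    ultimately show "\<xi> \<in> ?C" unfolding Suc T_decomp by blast
  qed
  \<comment> \<open>As \<open>1 / (3 - x) <= 1/2\<close>, the first branch can contribute only its
    minimum \<open>1/2\<close>.\<close>
  have sub2: "?C \<subseteq> insert (1 / 2) ?D"
  proof
    fix \<xi> assume xi: "\<xi> \<in> ?C"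
    hence le2: "\<xi> \<le> 1 / 2" using branch_bounds(5)[OF assms] by auto
    have "1 / 2 \<le> 1 / (1 + y)" if "y \<in> insert 0 (T k)" for y
      using T_branch_bounds(1)[OF that] .
    with le2 xi have "\<xi> = 1 / 2 \<or> \<xi> \<in> ?g ` T (k - 1) \<or> \<xi> \<in> ?h ` (T (k - 2) - {1})"
      unfolding Suc T_decomp by fastforce
    moreover have "\<xi> \<in> ?D" if xi2: "\<xi> \<in> ?h ` (T (k - 2) - {1})"
    proof -
      obtain y where y: "y \<in> T (k - 2)" "y \<noteq> 1" "\<xi> = ?h y" using xi2 by blast
      have "y \<le> x" using le[of y] y(3) xi T_range[OF y(1)] by auto
      thus ?thesis using y by blast
    qed
    ultimately show "\<xi> \<in> insert (1 / 2) ?D" by blast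
  qed
  have cD: "card ?D = M (k - 1) + card (?A - {1})"
  proof -
    have "?g y \<noteq> ?h z" if "y \<in> T (k - 1)" "z \<in> ?A - {1}" for y z
      using T_branch_bounds(2)[OF that(1)] T_branch_bounds(3)[of z "k - 2"] that(2) by force
    hence "?g ` T (k - 1) \<inter> ?h ` (?A - {1}) = {}" by blast
    hence "card ?D = card (?g ` T (k - 1)) + card (?h ` (?A - {1}))"
      by (intro card_Un_disjoint) (auto simp: finite_T)
    also have "card (?g ` T (k - 1)) = M (k - 1)" using T_subset by (rule card_branch_images)
    also have "card (?h ` (?A - {1})) = card (?A - {1})" using T_subset by (intro card_branch_images) blast
    finally show ?thesis .
  qed
  have "card ?D \<le> card ?C" using sub1 by (intro card_mono) (auto simp: finite_T)
  moreover have "card ?C \<le> card ?D + 1"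
  proof -
    have "card ?C \<le> card (insert (1 / 2) ?D)" by (rule card_mono[OF _ sub2]) (auto simp: finite_T)
    also have "\<dots> \<le> card ?D + 1" by (simp add: card_insert_if finite_T)
    finally show ?thesis .
  qed
  moreover have "card (?A - {1}) \<le> card ?A" by (intro card_mono) (auto simp: finite_T)
  moreover have "card ?A \<le> card (?A - {1}) + 1"
  proof -
    have "card ?A \<le> card (insert 1 (?A - {1}))" by (intro card_mono) (auto simp: finite_T)
    also have "\<dots> \<le> card (?A - {1}) + 1" by (rule card_insert_le_m1) auto
    finally show ?thesis .
  qed
  moreover have "card ?A = N (m - 3) x" "card ?C = N m (?h x)"
    by (simp_all add: N_def Suc eval_nat_numeral)
  ultimately show ?thesis using cD by (simp add: Suc eval_nat_numeral) linarith
qed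

text \<open>The base cases are \<open>a = 1\<close> with sign \<open>1\<close> and
  \<open>a = 3\<close> with sign \<open>-1\<close>. Every other digit is lowered by \<open>2\<close>
  through \<open>N_shift\<close>, which is exact, so the error does not grow with
  \<open>a\<close>.\<close>

lemma N_branch:
  fixes e :: int
  assumes "odd a" "e \<in> {1, -1}" "int a + e \<ge> 2" "0 \<le> x" "x \<le> 1"
  shows "\<bar>real (N m (1 / (real a + of_int e * x))) - (real (M (m - (a - 1))) - of_int e * real (N (m - a) x))\<bar> \<le> 1"
  using assms
proof (induction a arbitrary: m rule: less_induct)
  case (less a)
  consider "a = 1" "e = 1" | "a = 3" "e = -1" | b where "a = b + 2" "odd b" "int b + e \<ge> 2"
  proof -
    have "a = 1 \<or> a = 3 \<or> a \<ge> 5" using less.prems(1) by presburger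
    moreover have "\<exists>b. a = b + 2 \<and> odd b" if "a \<ge> 3"
      using that less.prems(1) by (intro exI[of _ "a - 2"]) auto
    ultimately show ?thesis using that less.prems(2,3) by force
  qed
  thus ?case
  proof cases
    case 1
    thus ?thesis using N_branch_plus[of x m] less.prems by simp
  next
    case 2
    thus ?thesis using N_branch_minus[of x m] less.prems by simp
  next
    case (3 b)
    let ?z = "1 / (real b + of_int e * x)"
    have b1: "1 \<le> real b" using 3(2) by (cases b) auto
    have "2 \<le> real b + of_int e" using 3(3) by linarith
    hence ge: "1 \<le> real b + of_int e * x" using less.prems b1 by auto
    have "1 / (real a + of_int e * x) = ?z / (1 + 2 * ?z)" using ge 3(1) by (auto simp: field_simps)
    moreover have "N m (?z / (1 + 2 * ?z)) = N (m - 2) ?z" using ge by (intro N_shift) auto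
    moreover have "m - (a - 1) = m - 2 - (b - 1)" "m - a = m - 2 - b" using 3(1) b1 by auto
    ultimately show ?thesis using less.IH[of b "m - 2"] 3 less.prems by simp
  qed
qed

subsection \<open>Asymptotics of the tribonacci sequence\<close>

text \<open>The lower bound exceeds \<open>5/3\<close>, where the quadratic cofactor has no real
  root; the upper bound stays below \<open>2\<close>, which later bounds the complex roots.\<close>

lemma lam_props: "lam ^ 3 = lam ^ 2 + lam + 1" "1.8 < lam" "lam < 1.9"
proof -
  let ?p = "\<lambda>r::real. r ^ 3 - r ^ 2 - r - 1"
  have "\<exists>r\<ge>1.8. r \<le> 1.9 \<and> ?p r = 0"
    by (rule IVT') (auto simp: power3_eq_cube power2_eq_square intro!: continuous_intros)
  then obtain r where r: "1.8 \<le> r" "r \<le> 1.9" "?p r = 0" by auto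
  have "?p 1.8 \<noteq> 0" "?p 1.9 \<noteq> 0" by (simp_all add: power3_eq_cube power2_eq_square)
  hence "r \<noteq> 1.8" "r \<noteq> 1.9" using r(3) by metis+
  have uniq: "s = r" if "?p s = 0" for s
  proof (rule ccontr)
    assume "s \<noteq> r"
    have "(s - r) * (s\<^sup>2 + (r - 1) * s + (r\<^sup>2 - r - 1)) = ?p s - ?p r"
      by (simp add: algebra_simps power3_eq_cube power2_eq_square)
    hence "s\<^sup>2 + (r - 1) * s + (r\<^sup>2 - r - 1) = 0" using that r \<open>s \<noteq> r\<close> by simp
    \<comment> \<open>Completing the square: the right side is the discriminant of the quadratic in
      \<open>s\<close>.\<close>
    hence "(2 * s + r - 1)\<^sup>2 = (5 - 3 * r) * (1 + r)" by (simp add: algebra_simps power2_eq_square)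
    moreover have "(5 - 3 * r) * (1 + r) < 0" using r by (intro mult_neg_pos) auto
    ultimately show False by (metis not_less zero_le_power2)
  qed
  have "lam = r" unfolding lam_def by (rule the_equality, rule r(3), rule uniq)
  thus "lam ^ 3 = lam ^ 2 + lam + 1" "1.8 < lam" "lam < 1.9"
    using r \<open>r \<noteq> 1.8\<close> \<open>r \<noteq> 1.9\<close> by simp_all
qed

text \<open>Shifting and subtracting \<open>lam\<close> times the sequence removes the growing
  solution \<open>lam ^ m\<close>; what remains belongs to the two complex roots, which lie inside
  the unit disc.\<close>

lemma tribonacci_ratio_error_bounded:
  fixes u :: "nat \<Rightarrow> real"
  assumes "\<And>m. u (m + 3) = u (m + 2) + u (m + 1) + u m"
  obtains C where "\<And>m. \<bar>u (Suc m) - lam * u m\<bar> \<le> C"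
proof -
  define v where "v m = u (Suc m) - lam * u m" for m
  \<comment> \<open>The coefficients come from
    \<open>x^3 - x^2 - x - 1 = (x - lam) * (x^2 + b * x + c)\<close>.\<close>
  define b c where "b = lam - 1" and "c = 1 / lam"
  \<comment> \<open>\<open>v\<close> satisfies the recurrence of the two complex roots, of modulus \<open>sqrt c < 1\<close>;
    \<open>Q\<close> is the positive definite form that this recurrence scales by \<open>c\<close>.\<close>
  define Q where "Q m = (v (Suc m))\<^sup>2 + b * v m * v (Suc m) + c * (v m)\<^sup>2" for m
  note l = lam_props
  have c: "0 < c" "c \<le> 1" using l by (auto simp: c_def)
  have lc: "lam * c = 1" using l by (auto simp: c_def)
  have bc: "lam * b = 1 + c"
  proof -
    have "lam * (lam * b) = lam * (1 + c)"
      using l(1) lc by (simp add: b_def algebra_simps power2_eq_square power3_eq_cube)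
    thus ?thesis using l by simp
  qed
  have rec: "v (m + 2) = - b * v (m + 1) - c * v m" for m
  proof -
    have "- b * v (m + 1) - c * v m = - b * u (m + 2) + (lam * b) * u (m + 1) - c * u (m + 1) + (lam * c) * u m"
      by (simp add: v_def algebra_simps eval_nat_numeral)
    also have "\<dots> = u (m + 3) - lam * u (m + 2)"
      unfolding bc lc assms by (simp add: b_def algebra_simps)
    finally show ?thesis by (simp add: v_def eval_nat_numeral)
  qed
  have Qs: "Q (Suc m) = c * Q m" for m
  proof -
    have vv: "v (Suc (Suc m)) = - b * v (Suc m) - c * v m" using rec[of m] by simp
    show ?thesis unfolding Q_def vv by (simp add: algebra_simps power2_eq_square)
  qed
  \<comment> \<open>Positive definiteness of \<open>Q\<close>: \<open>lam < 2\<close> gives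
    \<open>b <= 1\<close> and \<open>c > 1/2\<close>.\<close>
  have disc: "0 < c - b\<^sup>2 / 4"
  proof -
    have "b\<^sup>2 \<le> 1\<^sup>2" using l by (intro power_mono) (auto simp: b_def)
    moreover have "1/2 < c" using l by (auto simp: c_def field_simps)
    ultimately show ?thesis by simp
  qed
  have Qlow: "(c - b\<^sup>2 / 4) * (v m)\<^sup>2 \<le> Q m" for m
  proof -
    have "Q m = (v (Suc m) + b / 2 * v m)\<^sup>2 + (c - b\<^sup>2 / 4) * (v m)\<^sup>2"
      by (simp add: Q_def algebra_simps power2_eq_square)
    thus ?thesis by simp
  qed
  have Qnn: "0 \<le> Q m" for m using Qlow[of m] disc by (meson order_trans mult_nonneg_nonneg less_imp_le zero_le_power2)
  have Q0: "Q m \<le> Q 0" for m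
  proof (induction m)
    case (Suc m)
    have "Q (Suc m) \<le> 1 * Q m" unfolding Qs using c Qnn by (intro mult_right_mono) auto
    thus ?case using Suc by simp
  qed simp
  have "\<bar>v m\<bar> \<le> sqrt (Q 0 / (c - b\<^sup>2 / 4))" for m
  proof -
    have "(c - b\<^sup>2 / 4) * (v m)\<^sup>2 \<le> Q 0" using Qlow Q0 order_trans by blast
    hence "(v m)\<^sup>2 \<le> Q 0 / (c - b\<^sup>2 / 4)" using disc by (simp add: field_simps)
    thus ?thesis by (simp add: real_le_rsqrt abs_le_square_iff)
  qed
  thus ?thesis using that unfolding v_def by blast
qed

lemma M_at_top: "filterlim (\<lambda>m. real (M m)) at_top sequentially"
  by (rule filterlim_at_top_mono[OF filterlim_real_sequentially]) (simp add: M_ge)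

lemma inverse_M_tendsto: "(\<lambda>m. c / real (M m)) \<longlonglongrightarrow> 0"
  by (rule tendsto_divide_0[OF tendsto_const filterlim_at_top_imp_at_infinity[OF M_at_top]])

lemma null_comparison:
  fixes f g :: "nat \<Rightarrow> real"
  assumes "\<forall>\<^sub>F m in sequentially. norm (f m) \<le> g m" "g \<longlonglongrightarrow> 0"
  shows "f \<longlonglongrightarrow> 0"
  using assms(2) by (rule tendsto_0_le[where K = 1]) (use assms(1) in eventually_elim, auto)

lemma M_ratio: "(\<lambda>m. real (M m) / real (M (Suc m))) \<longlonglongrightarrow> 1 / lam"
proof -
  \<comment> \<open>The index is shifted because the recurrence for \<open>M\<close> starts at
    \<open>1\<close>.\<close>
  have "real (M (Suc (m + 3))) = real (M (Suc (m + 2))) + real (M (Suc (m + 1))) + real (M (Suc m))" for m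
    using M_tribonacci[of "Suc m"] by simp
  then obtain C where C: "\<And>m. \<bar>real (M (Suc (Suc m))) - lam * real (M (Suc m))\<bar> \<le> C"
    using tribonacci_ratio_error_bounded[of "\<lambda>m. real (M (Suc m))"] by blast
  have Mp: "0 < real (M (Suc m))" for m using M_ge[of "Suc m"] by linarith
  have "(\<lambda>m. real (M (Suc (Suc m))) / real (M (Suc m)) - lam) \<longlonglongrightarrow> 0"
  proof (rule null_comparison)
    show "\<forall>\<^sub>F m in sequentially. norm (real (M (Suc (Suc m))) / real (M (Suc m)) - lam) \<le> C / real (M (Suc m))"
    proof (intro always_eventually allI)
      fix m
      have "real (M (Suc (Suc m))) / real (M (Suc m)) - lam
          = (real (M (Suc (Suc m))) - lam * real (M (Suc m))) / real (M (Suc m))"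
        using Mp[of m] by (simp add: field_simps)
      thus "norm (real (M (Suc (Suc m))) / real (M (Suc m)) - lam) \<le> C / real (M (Suc m))"
        using C[of m] Mp[of m] by (simp add: divide_right_mono)
    qed
    show "(\<lambda>m. C / real (M (Suc m))) \<longlonglongrightarrow> 0"
      by (rule LIMSEQ_Suc[OF inverse_M_tendsto])
  qed
  hence "(\<lambda>m. real (M (Suc (Suc m))) / real (M (Suc m))) \<longlonglongrightarrow> lam"
    by (simp add: LIM_zero_iff)
  hence "(\<lambda>m. inverse (real (M (Suc (Suc m))) / real (M (Suc m)))) \<longlonglongrightarrow> inverse lam"
    using lam_props by (intro tendsto_inverse) auto
  hence "(\<lambda>m. real (M (Suc m)) / real (M (Suc (Suc m)))) \<longlonglongrightarrow> 1 / lam"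
    by (simp add: divide_simps)
  thus ?thesis by (rule LIMSEQ_imp_Suc)
qed

text \<open>The quotient is a product of \<open>j\<close> consecutive ratios, each tending to
  \<open>1 / lam\<close>.\<close>

lemma M_ratio_diff: "(\<lambda>m. real (M (m - j)) / real (M m)) \<longlonglongrightarrow> 1 / lam ^ j"
proof (induction j)
  case 0
  have "\<forall>\<^sub>F m in sequentially. real (M m) / real (M m) = 1"
  proof (rule eventually_sequentiallyI[of 1])
    show "real (M m) / real (M m) = 1" if "1 \<le> m" for m using M_ge[of m] that by auto
  qed
  thus ?case by (simp add: tendsto_eventually)
next
  case (Suc j)
  have "(\<lambda>m. real (M (m - j)) / real (M (Suc m - j))) \<longlonglongrightarrow> 1 / lam"
  proof -
    have "(\<lambda>m. real (M (m - j)) / real (M (Suc (m - j)))) \<longlonglongrightarrow> 1 / lam"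
      by (rule filterlim_compose[OF M_ratio]) (rule filterlim_minus_const_nat_at_top)
    thus ?thesis
      by (rule Lim_transform_eventually) (auto simp: eventually_sequentially Suc_diff_le intro!: exI[of _ j])
  qed
  moreover have "(\<lambda>m. real (M (Suc m - j)) / real (M (Suc m))) \<longlonglongrightarrow> 1 / lam ^ j"
    using Suc by (rule LIMSEQ_Suc)
  ultimately have "(\<lambda>m. real (M (m - j)) / real (M (Suc m - j)) * (real (M (Suc m - j)) / real (M (Suc m))))
      \<longlonglongrightarrow> 1 / lam * (1 / lam ^ j)" by (rule tendsto_mult)
  hence "(\<lambda>m. real (M (m - j)) / real (M (Suc m))) \<longlonglongrightarrow> 1 / lam ^ Suc j"
  proof (rule Lim_transform_eventually[THEN tendsto_eq_rhs])
    show "\<forall>\<^sub>F m in sequentially. real (M (m - j)) / real (M (Suc m - j)) * (real (M (Suc m - j)) / real (M (Suc m)))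
        = real (M (m - j)) / real (M (Suc m))"
    proof (rule eventually_sequentiallyI[of j])
      fix m assume "j \<le> m"
      hence "0 < M (Suc m - j)" using M_ge[of "Suc m - j"] by linarith
      thus "real (M (m - j)) / real (M (Suc m - j)) * (real (M (Suc m - j)) / real (M (Suc m)))
        = real (M (m - j)) / real (M (Suc m))" by simp
    qed
  qed simp
  thus ?case by (subst filterlim_sequentially_Suc[symmetric]) simp
qed

section \<open>From counts to the distribution functions\<close>

lemma F0n_eq:
  assumes "0 \<le> x"
  shows "F0n n x = (1 + real (N (Suc n) x)) / (1 + real (M (Suc n)))"
proof -
  have "0 \<notin> T (Suc n)" using T_range[of 0] by auto
  moreover have "{\<xi> \<in> insert 0 (T (Suc n)). \<xi> \<le> x} = insert 0 {\<xi> \<in> T (Suc n). \<xi> \<le> x}"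
    using assms by auto
  ultimately show ?thesis by (simp add: F0n_def Y_set_eq N_def finite_T)
qed

text \<open>The point \<open>0\<close> adds \<open>1\<close> to numerator and denominator, which
  disappears after division by \<open>M m\<close>.\<close>

lemma F0n_tendsto:
  assumes "0 \<le> x" "(\<lambda>m. real (N m x) / real (M m)) \<longlonglongrightarrow> c"
  shows "(\<lambda>n. F0n n x) \<longlonglongrightarrow> c"
proof -
  have "(\<lambda>m. (1 / real (M m) + real (N m x) / real (M m)) / (1 / real (M m) + 1)) \<longlonglongrightarrow> (0 + c) / (0 + 1)"
    by (intro tendsto_intros inverse_M_tendsto assms) auto
  from LIMSEQ_Suc[OF this]
  have "(\<lambda>n. (1 / real (M (Suc n)) + real (N (Suc n) x) / real (M (Suc n))) / (1 / real (M (Suc n)) + 1)) \<longlonglongrightarrow> c"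
    by simp
  moreover have "(1 / real (M (Suc n)) + real (N (Suc n) x) / real (M (Suc n))) / (1 / real (M (Suc n)) + 1) = F0n n x" for n
  proof -
    have "0 < real (M (Suc n))" using M_ge[of "Suc n"] by linarith
    hence "1 / real (M (Suc n)) + 1 = (1 + real (M (Suc n))) / real (M (Suc n))"
      by (simp add: add_divide_distrib)
    thus ?thesis using assms(1) \<open>0 < real (M (Suc n))\<close>
      by (simp add: F0n_eq add_divide_distrib[symmetric])
  qed
  ultimately show ?thesis by simp
qed

subsection \<open>Iteration along an expansion\<close>

text \<open>Infinite digit sequences; finite expansions are padded with \<open>a = 1\<close>, \<open>eps = 1\<close>.\<close>

definition good_digits :: "(nat \<Rightarrow> int) \<Rightarrow> (nat \<Rightarrow> nat) \<Rightarrow> bool" where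
  "good_digits eps a \<longleftrightarrow> eps 1 = 1 \<and>
     (\<forall>i\<ge>1. odd (a i) \<and> eps i \<in> {1, -1} \<and> int (a i) + eps (Suc i) \<ge> 2)"

lemma good_denom:
  assumes "good_digits eps a" "i \<ge> 1" "0 \<le> y" "y \<le> 1"
  shows "1 \<le> real (a i) + of_int (eps (Suc i)) * y"
proof -
  have "1 \<le> a i" "eps (Suc i) \<in> {1, -1}" "int (a i) + eps (Suc i) \<ge> 2"
    using assms(1,2) unfolding good_digits_def by (auto intro: Suc_leI odd_pos)
  hence "1 \<le> real (a i)" "2 \<le> real (a i) + of_int (eps (Suc i))" by linarith+
  thus ?thesis using assms \<open>eps (Suc i) \<in> {1, -1}\<close> by auto
qed

lemma good_sum_ge:
  assumes "good_digits eps a"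
  shows "k \<le> (\<Sum>i=1..k. a i)"
proof -
  have "1 \<le> a i" if "i \<ge> 1" for i
    using assms that unfolding good_digits_def by (auto intro: Suc_leI odd_pos)
  hence "(\<Sum>i=1..k. 1) \<le> (\<Sum>i=1..k. a i)" by (intro sum_mono) auto
  thus ?thesis by simp
qed

lemma abs_cf_E:
  assumes "good_digits eps a"
  shows "\<bar>cf_E eps k\<bar> = 1"
proof (induction k)
  case (Suc k)
  have "cf_E eps (Suc k) = cf_E eps k * - eps (Suc k)" by (simp add: cf_E_def)
  moreover have "eps (Suc k) = 1 \<or> eps (Suc k) = -1" using assms by (auto simp: good_digits_def)
  ultimately show ?case using Suc by auto
qed (simp add: cf_E_def)

text \<open>\<open>N_branch\<close> is applied to the remaining count at each digit. The factors
  \<open>-e\<close> multiply up to \<open>cf_E\<close>, of modulus 1, so each digit adds at most 1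
  to the error. Only finitely many tails \<open>y\<close> are required, which serves both kinds of
  expansion.\<close>

lemma N_expansion:
  assumes g: "good_digits eps a"
    and y: "\<And>i. 1 \<le> i \<Longrightarrow> i \<le> Suc k \<Longrightarrow> 0 \<le> y i \<and> y i \<le> 1"
    and rec: "\<And>i. 1 \<le> i \<Longrightarrow> i \<le> k \<Longrightarrow> y i = 1 / (real (a i) + of_int (eps (Suc i)) * y (Suc i))"
  shows "\<bar>real (N m (y 1)) + (\<Sum>i=1..k. of_int (cf_E eps i) * real (M (m - cf_A a i)))
      + of_int (cf_E eps (Suc k)) * real (N (m - (\<Sum>i=1..k. a i)) (y (Suc k)))\<bar> \<le> real k"
  using y rec
proof (induction k)
  case 0
  thus ?case using g by (simp add: cf_E_def good_digits_def)
next
  case (Suc k)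
  let ?B = "\<Sum>i=1..k. a i"
  let ?S = "\<Sum>i=1..k. of_int (cf_E eps i) * real (M (m - cf_A a i))"
  let ?E = "of_int (cf_E eps (Suc k)) :: real"
  let ?e = "of_int (eps (Suc (Suc k))) :: real"
  have IH: "\<bar>real (N m (y 1)) + ?S + ?E * real (N (m - ?B) (y (Suc k)))\<bar> \<le> real k"
    by (rule Suc.IH; rule Suc.prems; simp)
  have E: "\<bar>?E\<bar> = 1"
    using abs_cf_E[OF g] by (metis of_int_1 of_int_abs)
  have ge: "1 \<le> a (Suc k)" using g by (auto simp: good_digits_def intro: Suc_leI odd_pos)
  \<comment> \<open>This is where the \<open>-1\<close> in \<open>cf_A\<close> arises: the last
    digit enters the argument of \<open>M\<close> as \<open>a - 1\<close>, the earlier ones in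
    full.\<close>
  have i1: "m - ?B - (a (Suc k) - 1) = m - cf_A a (Suc k)" using ge by (simp add: cf_A_def)
  have i2: "m - ?B - a (Suc k) = m - (\<Sum>i=1..Suc k. a i)" by simp
  have yk: "y (Suc k) = 1 / (real (a (Suc k)) + ?e * y (Suc (Suc k)))"
    by (rule Suc.prems(2)) simp_all
  have "\<bar>real (N (m - ?B) (1 / (real (a (Suc k)) + ?e * y (Suc (Suc k)))))
      - (real (M (m - ?B - (a (Suc k) - 1))) - ?e * real (N (m - ?B - a (Suc k)) (y (Suc (Suc k)))))\<bar> \<le> 1"
    by (rule N_branch) (use g Suc.prems(1)[of "Suc (Suc k)"] in \<open>auto simp: good_digits_def\<close>)
  hence br: "\<bar>real (N (m - ?B) (y (Suc k)))
      - (real (M (m - cf_A a (Suc k))) - ?e * real (N (m - (\<Sum>i=1..Suc k. a i)) (y (Suc (Suc k)))))\<bar> \<le> 1"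
    unfolding yk[symmetric] i1 i2 .
  let ?X = "real (N (m - ?B) (y (Suc k)))"
  let ?Y = "real (M (m - cf_A a (Suc k))) - ?e * real (N (m - (\<Sum>i=1..Suc k. a i)) (y (Suc (Suc k))))"
  have "\<bar>?E * ?X - ?E * ?Y\<bar> = \<bar>?E\<bar> * \<bar>?X - ?Y\<bar>"
    by (simp only: abs_mult[symmetric] right_diff_distrib)
  hence d: "\<bar>?E * ?X - ?E * ?Y\<bar> \<le> 1"
    unfolding E mult_1 by (rule ord_eq_le_trans[OF _ br])
  have E2: "of_int (cf_E eps (Suc (Suc k))) = - ?e * ?E" by (simp add: cf_E_def)
  have "real (N m (y 1)) + (\<Sum>i=1..Suc k. of_int (cf_E eps i) * real (M (m - cf_A a i)))
      + of_int (cf_E eps (Suc (Suc k))) * real (N (m - (\<Sum>i=1..Suc k. a i)) (y (Suc (Suc k))))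
      = (real (N m (y 1)) + ?S + ?E * ?X) - (?E * ?X - ?E * ?Y)"
    unfolding E2 by (simp add: algebra_simps)
  thus ?case using IH d by linarith
qed

lemma partial_sum_tendsto:
  "(\<lambda>m. (\<Sum>i=1..k. of_int (cf_E eps i) * real (M (m - cf_A a i))) / real (M m))
    \<longlonglongrightarrow> (\<Sum>i=1..k. of_int (cf_E eps i) / lam ^ cf_A a i)"
proof -
  have "(\<lambda>m. \<Sum>i=1..k. of_int (cf_E eps i) * (real (M (m - cf_A a i)) / real (M m)))
    \<longlonglongrightarrow> (\<Sum>i=1..k. of_int (cf_E eps i) * (1 / lam ^ cf_A a i))"
    by (intro tendsto_intros M_ratio_diff)
  thus ?thesis by (simp add: sum_divide_distrib)
qed

text \<open>First \<open>k\<close> is fixed with \<open>s k\<close> near \<open>S\<close> and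
  \<open>t k\<close> near \<open>0\<close>, then \<open>m\<close> is taken large. The four quarters
  of \<open>\<epsilon>\<close> pay for \<open>h - t\<close>, \<open>t\<close>, \<open>g - s\<close>
  and \<open>s - S\<close>.\<close>

lemma tendsto_by_approximations:
  fixes f :: "nat \<Rightarrow> real"
  assumes le: "\<And>k m. \<bar>f m - g k m\<bar> \<le> h k m"
    and g: "\<And>k. g k \<longlonglongrightarrow> s k" and h: "\<And>k. h k \<longlonglongrightarrow> t k"
    and s: "s \<longlonglongrightarrow> S" and t: "t \<longlonglongrightarrow> 0"
  shows "f \<longlonglongrightarrow> S"
proof (rule tendstoI)
  fix \<epsilon> :: real assume "\<epsilon> > 0"
  hence e4: "\<epsilon> / 4 > 0" by simp
  have "\<forall>\<^sub>F k in sequentially. dist (s k) S < \<epsilon> / 4 \<and> dist (t k) 0 < \<epsilon> / 4"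
    using tendstoD[OF s e4] tendstoD[OF t e4] by eventually_elim auto
  then obtain k where k: "dist (s k) S < \<epsilon> / 4" "dist (t k) 0 < \<epsilon> / 4"
    by (auto simp: eventually_sequentially)
  show "\<forall>\<^sub>F m in sequentially. dist (f m) S < \<epsilon>"
    using tendstoD[OF g[of k] e4] tendstoD[OF h[of k] e4]
  proof eventually_elim
    case (elim m)
    thus ?case using k le[of m k] unfolding dist_real_def by linarith
  qed
qed

lemma N_ratio_approx:
  assumes g: "good_digits eps a"
    and y: "\<And>i. 1 \<le> i \<Longrightarrow> i \<le> Suc k \<Longrightarrow> 0 \<le> y i \<and> y i \<le> 1"
    and rec: "\<And>i. 1 \<le> i \<Longrightarrow> i \<le> k \<Longrightarrow> y i = 1 / (real (a i) + of_int (eps (Suc i)) * y (Suc i))"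
  shows "\<bar>real (N m (y 1)) / real (M m)
      - - ((\<Sum>i=1..k. of_int (cf_E eps i) * real (M (m - cf_A a i))) / real (M m))\<bar>
      \<le> real k / real (M m) + real (N (m - (\<Sum>i=1..k. a i)) (y (Suc k))) / real (M m)"
proof -
  let ?S = "\<Sum>i=1..k. of_int (cf_E eps i) * real (M (m - cf_A a i))"
  let ?Z = "real (N (m - (\<Sum>i=1..k. a i)) (y (Suc k)))"
  have "\<bar>real_of_int (cf_E eps (Suc k))\<bar> = 1" using abs_cf_E[OF g] by (metis of_int_1 of_int_abs)
  hence "\<bar>of_int (cf_E eps (Suc k)) * ?Z\<bar> = ?Z" by (simp add: abs_mult)
  hence "\<bar>real (N m (y 1)) + ?S\<bar> \<le> real k + ?Z"
    using N_expansion[OF g y rec, of k m] by linarith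
  hence "\<bar>real (N m (y 1)) + ?S\<bar> / real (M m) \<le> (real k + ?Z) / real (M m)"
    by (intro divide_right_mono) auto
  thus ?thesis by (simp add: add_divide_distrib[symmetric])
qed

section \<open>Tails of an expansion and their limits\<close>

lemma cf_frac_tail_range:
  assumes g: "good_digits eps a"
  shows "1 \<le> i \<Longrightarrow> \<exists>v. cf_frac m eps a i = of_int (eps i) * v \<and> 0 \<le> v \<and> v \<le> 1"
proof (induction m arbitrary: i)
  case 0
  thus ?case by auto
next
  case (Suc m)
  then obtain v where v: "cf_frac m eps a (Suc i) = of_int (eps (Suc i)) * v" "0 \<le> v" "v \<le> 1" by force
  from good_denom[OF g Suc.prems v(2,3)] v show ?case
    by (intro exI[of _ "1 / (real (a i) + of_int (eps (Suc i)) * v)"]) auto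
qed

text \<open>Because \<open>eps i\<close> squares to \<open>1\<close>, this factor strips the leading
  sign and leaves a value in \<open>[0,1]\<close>.\<close>

definition cf_tail :: "nat \<Rightarrow> (nat \<Rightarrow> int) \<Rightarrow> (nat \<Rightarrow> nat) \<Rightarrow> nat \<Rightarrow> real" where
  "cf_tail m eps a i = of_int (eps i) * cf_frac m eps a i"

lemma cf_tail_range:
  assumes "good_digits eps a" "1 \<le> i"
  shows "0 \<le> cf_tail m eps a i" "cf_tail m eps a i \<le> 1"
proof -
  have "eps i = 1 \<or> eps i = -1" using assms by (auto simp: good_digits_def)
  with cf_frac_tail_range[OF assms, of m]
  show "0 \<le> cf_tail m eps a i" "cf_tail m eps a i \<le> 1" by (auto simp: cf_tail_def)
qed

lemma cf_tail_Suc: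
  assumes "good_digits eps a" "1 \<le> i"
  shows "cf_tail (Suc m) eps a i = 1 / (real (a i) + of_int (eps (Suc i)) * cf_tail m eps a (Suc i))"
proof -
  have "eps i \<in> {1, -1}" "eps (Suc i) \<in> {1, -1}" using assms by (auto simp: good_digits_def)
  thus ?thesis by (auto simp: cf_tail_def)
qed

text \<open>
  A limit \<open>x\<close> of tails is nonzero, so that \<open>x = 1/(a + e x')\<close> can be solved for the limit \<open>x'\<close>
  of the next tails.
\<close>

lemma cf_tail_convergent:
  assumes g: "good_digits eps a" and lim: "(\<lambda>m. cf_frac m eps a 1) \<longlonglongrightarrow> x"
  shows "\<exists>z. (\<lambda>m. cf_tail m eps a (Suc i)) \<longlonglongrightarrow> z"
proof (induction i)
  case 0
  have "cf_tail m eps a 1 = cf_frac m eps a 1" for m using g by (simp add: cf_tail_def good_digits_def)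
  thus ?case using lim by auto
next
  case (Suc i)
  let ?i = "Suc i"
  let ?e = "of_int (eps (Suc ?i)) :: real"
  from Suc obtain z where z: "(\<lambda>m. cf_tail m eps a ?i) \<longlonglongrightarrow> z" by blast
  hence z1: "(\<lambda>m. cf_tail (Suc m) eps a ?i) \<longlonglongrightarrow> z" by (rule LIMSEQ_Suc)
  have e: "?e = 1 \<or> ?e = -1" using g by (auto simp: good_digits_def)
  have den: "1 \<le> real (a ?i) + ?e * cf_tail m eps a (Suc ?i)" for m
    using cf_tail_range[OF g, of "Suc ?i" m] by (intro good_denom[OF g]) auto
  have den2: "real (a ?i) + ?e * cf_tail m eps a (Suc ?i) \<le> real (a ?i) + 1" for m
    using cf_tail_range[OF g, of "Suc ?i" m] e by auto
  \<comment> \<open>A lower bound independent of \<open>m\<close>, which survives in the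
    limit.\<close>
  have "1 / (real (a ?i) + 1) \<le> cf_tail (Suc m) eps a ?i" for m
    unfolding cf_tail_Suc[OF g, of ?i, simplified] using den[of m] den2[of m] by (intro divide_left_mono) auto
  hence "1 / (real (a ?i) + 1) \<le> z" by (intro LIMSEQ_le_const[OF z1]) auto
  moreover have "0 < 1 / (real (a ?i) + 1)" by simp
  ultimately have "z \<noteq> 0" by linarith
  hence "(\<lambda>m. ?e * (1 / cf_tail (Suc m) eps a ?i - real (a ?i))) \<longlonglongrightarrow> ?e * (1 / z - real (a ?i))"
    by (intro tendsto_intros z1)
  moreover have "?e * (1 / cf_tail (Suc m) eps a ?i - real (a ?i)) = cf_tail m eps a (Suc ?i)" for m
    using e unfolding cf_tail_Suc[OF g, of ?i, simplified] by auto
  ultimately show ?case by auto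
qed

text \<open>The recursion for truncated tails passes to the limit because the denominators stay at
  least \<open>1\<close>.\<close>

lemma infinite_tails:
  assumes g: "good_digits eps a" and lim: "(\<lambda>m. cf_frac m eps a 1) \<longlonglongrightarrow> x"
  obtains y where "y 1 = x" "\<And>i. 1 \<le> i \<Longrightarrow> 0 \<le> y i \<and> y i \<le> 1"
    "\<And>i. 1 \<le> i \<Longrightarrow> y i = 1 / (real (a i) + of_int (eps (Suc i)) * y (Suc i))"
proof -
  define y where "y i = lim (\<lambda>m. cf_tail m eps a i)" for i
  have y: "(\<lambda>m. cf_tail m eps a i) \<longlonglongrightarrow> y i" if "1 \<le> i" for i
    using cf_tail_convergent[OF assms, of "i - 1"] that
    unfolding y_def by (auto simp: convergent_def convergent_LIMSEQ_iff[symmetric])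
  have r: "0 \<le> y i \<and> y i \<le> 1" if "1 \<le> i" for i
    using cf_tail_range[OF g that] by (auto intro: LIMSEQ_le_const[OF y[OF that]] LIMSEQ_le_const2[OF y[OF that]])
  show ?thesis
  proof (rule that[of y])
    have "(\<lambda>m. cf_tail m eps a 1) \<longlonglongrightarrow> x" using lim g by (simp add: cf_tail_def good_digits_def)
    with y[of 1] show "y 1 = x" using LIMSEQ_unique by auto
  next
    fix i :: nat assume i: "1 \<le> i"
    show "0 \<le> y i \<and> y i \<le> 1" by (rule r[OF i])
    have "1 \<le> real (a i) + of_int (eps (Suc i)) * y (Suc i)"
      using r[of "Suc i"] by (intro good_denom[OF g i]) auto
    hence "(\<lambda>m. 1 / (real (a i) + of_int (eps (Suc i)) * cf_tail m eps a (Suc i)))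
        \<longlonglongrightarrow> 1 / (real (a i) + of_int (eps (Suc i)) * y (Suc i))"
      by (intro tendsto_intros y) auto
    moreover have "(\<lambda>m. cf_tail (Suc m) eps a i) \<longlonglongrightarrow> y i" using y[OF i] by (rule LIMSEQ_Suc)
    ultimately show "y i = 1 / (real (a i) + of_int (eps (Suc i)) * y (Suc i))"
      unfolding cf_tail_Suc[OF g i] using LIMSEQ_unique by blast
  qed
qed

section \<open>The limit formulas for finite and infinite expansions\<close>

text \<open>After all \<open>l\<close> digits the tail is \<open>0\<close> and its count vanishes,
  so only the error \<open>l / M m\<close> remains.\<close>

lemma F0n_tendsto_finite:
  assumes "0 \<le> x" and ex: "odd_cf_expansion x (enat l) eps a"
  shows "(\<lambda>n. F0n n x) \<longlonglongrightarrow> - (\<Sum>i=1..l. of_int (cf_E eps i) / lam ^ cf_A a i)"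
proof -
  have x: "x = cf_frac l eps a 1" and dig: "odd_cf_digits (enat l) eps a"
    using ex by (auto simp: odd_cf_expansion_def)
  note d1 = odd_cf_digits_enatD(1)[OF dig] and d2 = odd_cf_digits_enatD(2)[OF dig]
    and d3 = odd_cf_digits_enatD(3)[OF dig]
  define eps' where "eps' i = (if i \<le> l then eps i else 1)" for i
  define a' where "a' i = (if i \<le> l then a i else 1)" for i
  have g: "good_digits eps' a'"
    unfolding good_digits_def
  proof (intro conjI allI impI)
    show "eps' 1 = 1" using d2 by (auto simp: eps'_def)
    fix i :: nat assume i: "1 \<le> i"
    show o: "odd (a' i)" using d1[OF i] by (auto simp: a'_def)
    show "eps' i \<in> {1, -1}" using d1[OF i] by (auto simp: eps'_def)
    have "1 \<le> a' i" using o by (auto intro: Suc_leI odd_pos)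
    thus "2 \<le> int (a' i) + eps' (Suc i)" using d3[OF i] by (auto simp: a'_def eps'_def)
  qed
  \<comment> \<open>The tail at \<open>i\<close> gets exactly the \<open>Suc l - i\<close> levels
    left in the original expansion, so no padded digit enters and the tail at \<open>Suc l\<close>
    is \<open>0\<close>.\<close>
  define y where "y i = cf_tail (Suc l - i) eps' a' i" for i
  have y: "0 \<le> y i \<and> y i \<le> 1" if "1 \<le> i" for i
    using cf_tail_range[OF g that] by (simp add: y_def)
  have rec: "y i = 1 / (real (a' i) + of_int (eps' (Suc i)) * y (Suc i))" if "1 \<le> i" "i \<le> l" for i
    using cf_tail_Suc[OF g that(1), of "l - i"] that by (simp add: y_def Suc_diff_le)
  have y1: "y 1 = x"
  proof -
    have "cf_frac l eps' a' 1 = cf_frac l eps a 1"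
      by (rule cf_frac_cong) (auto simp: eps'_def a'_def)
    thus ?thesis using x g by (simp add: y_def cf_tail_def good_digits_def)
  qed
  have yl: "y (Suc l) = 0" by (simp add: y_def cf_tail_def)
  let ?g = "\<lambda>m. - ((\<Sum>i=1..l. of_int (cf_E eps' i) * real (M (m - cf_A a' i))) / real (M m))"
  have "(\<lambda>m. real (N m x) / real (M m) - ?g m) \<longlonglongrightarrow> 0"
  proof (rule null_comparison)
    show "\<forall>\<^sub>F m in sequentially. norm (real (N m x) / real (M m) - ?g m) \<le> real l / real (M m)"
    proof (intro always_eventually allI)
      fix m
      have "\<bar>real (N m (y 1)) / real (M m) - ?g m\<bar>
          \<le> real l / real (M m) + real (N (m - (\<Sum>i=1..l. a' i)) (y (Suc l))) / real (M m)"
        using N_ratio_approx[OF g, of l y m] y rec by blast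
      thus "norm (real (N m x) / real (M m) - ?g m) \<le> real l / real (M m)"
        unfolding y1 yl N_0 by simp
    qed
  qed (rule inverse_M_tendsto)
  moreover have "?g \<longlonglongrightarrow> - (\<Sum>i=1..l. of_int (cf_E eps' i) / lam ^ cf_A a' i)"
    by (intro tendsto_minus partial_sum_tendsto)
  ultimately have "(\<lambda>m. real (N m x) / real (M m)) \<longlonglongrightarrow> - (\<Sum>i=1..l. of_int (cf_E eps' i) / lam ^ cf_A a' i)"
    by (rule Lim_transform[rotated])
  moreover have "(\<Sum>i=1..l. of_int (cf_E eps' i) / lam ^ cf_A a' i) = (\<Sum>i=1..l. of_int (cf_E eps i) / lam ^ cf_A a i)"
    by (intro sum.cong refl arg_cong2[where f = "(/)"] arg_cong[where f = of_int] arg_cong[where f = "\<lambda>n. lam ^ n"])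
      (auto simp: cf_E_def cf_A_def eps'_def a'_def intro!: prod.cong sum.cong arg_cong[where f = "\<lambda>n. n - 1"])
  ultimately show ?thesis using F0n_tendsto assms(1) by simp
qed

text \<open>All digits are at least \<open>1\<close>, so the exponent is at least \<open>i\<close>
  and a geometric series dominates.\<close>

lemma summable_terms:
  assumes g: "good_digits eps a"
  shows "summable (\<lambda>i. of_int (cf_E eps (Suc i)) / lam ^ cf_A a (Suc i))"
proof (rule summable_comparison_test')
  show "summable (\<lambda>i. (1 / lam) ^ i)" using lam_props by (intro summable_geometric) auto
  fix i :: nat
  have "i \<le> cf_A a (Suc i)" using good_sum_ge[OF g, of "Suc i"] by (simp add: cf_A_def)
  hence "(1 / lam) ^ cf_A a (Suc i) \<le> (1 / lam) ^ i" using lam_props by (intro power_decreasing) auto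
  moreover have "\<bar>real_of_int (cf_E eps (Suc i))\<bar> = 1" using abs_cf_E[OF g] by (metis of_int_1 of_int_abs)
  ultimately show "norm (of_int (cf_E eps (Suc i)) / lam ^ cf_A a (Suc i)) \<le> (1 / lam) ^ i"
    using lam_props by (simp add: power_divide)
qed

text \<open>The remaining count never vanishes by itself; it is bounded by
  \<open>M (m - ?B k)\<close>, whose share of \<open>M m\<close> tends to
  \<open>1 / lam ^ ?B k\<close>, and this tends to \<open>0\<close> as \<open>k\<close>
  grows.\<close>

lemma F0n_tendsto_infinite:
  assumes "0 \<le> x" and g: "good_digits eps a" and lim: "(\<lambda>m. cf_frac m eps a 1) \<longlonglongrightarrow> x"
  shows "(\<lambda>n. F0n n x) \<longlonglongrightarrow> - (\<Sum>i. of_int (cf_E eps (Suc i)) / lam ^ cf_A a (Suc i))"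
proof -
  obtain y where y1: "y 1 = x" and y: "\<And>i. 1 \<le> i \<Longrightarrow> 0 \<le> y i \<and> y i \<le> 1"
    and rec: "\<And>i. 1 \<le> i \<Longrightarrow> y i = 1 / (real (a i) + of_int (eps (Suc i)) * y (Suc i))"
    using infinite_tails[OF g lim] by blast
  let ?g = "\<lambda>k m. - ((\<Sum>i=1..k. of_int (cf_E eps i) * real (M (m - cf_A a i))) / real (M m))"
  let ?B = "\<lambda>k. \<Sum>i=1..k. a i"
  let ?h = "\<lambda>k m. real k / real (M m) + real (M (m - ?B k)) / real (M m)"
  let ?c = "\<lambda>i. of_int (cf_E eps i) / lam ^ cf_A a i"
  have "(\<lambda>m. real (N m x) / real (M m)) \<longlonglongrightarrow> - (\<Sum>i. ?c (Suc i))"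
  proof (rule tendsto_by_approximations[of _ ?g ?h "\<lambda>k. - (\<Sum>i=1..k. ?c i)" "\<lambda>k. 0 + 1 / lam ^ ?B k"])
    fix k m
    have "real (N (m - ?B k) (y (Suc k))) / real (M m) \<le> real (M (m - ?B k)) / real (M m)"
      using N_le_M by (intro divide_right_mono) auto
    thus "\<bar>real (N m x) / real (M m) - ?g k m\<bar> \<le> ?h k m"
      using N_ratio_approx[OF g y rec, of k m] unfolding y1 by linarith
  next
    fix k
    show "?g k \<longlonglongrightarrow> - (\<Sum>i=1..k. ?c i)"
      by (intro tendsto_minus partial_sum_tendsto)
    show "?h k \<longlonglongrightarrow> 0 + 1 / lam ^ ?B k"
      by (intro tendsto_add inverse_M_tendsto M_ratio_diff)
  next
    have "(\<Sum>i=1..k. ?c i) = (\<Sum>i<k. ?c (Suc i))" for k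
      by (rule sum.reindex_bij_witness[of _ Suc "\<lambda>i. i - 1"]) auto
    thus "(\<lambda>k. - (\<Sum>i=1..k. ?c i)) \<longlonglongrightarrow> - (\<Sum>i. ?c (Suc i))"
      using summable_LIMSEQ[OF summable_terms[OF g]] by (auto intro: tendsto_minus)
  next
    have "(\<lambda>k. 1 / lam ^ ?B k) \<longlonglongrightarrow> 0"
    proof (rule null_comparison)
      show "\<forall>\<^sub>F k in sequentially. norm (1 / lam ^ ?B k) \<le> (1 / lam) ^ k"
      proof (intro always_eventually allI)
        fix k
        have "(1 / lam) ^ ?B k \<le> (1 / lam) ^ k"
          using good_sum_ge[OF g] lam_props by (intro power_decreasing) auto
        thus "norm (1 / lam ^ ?B k) \<le> (1 / lam) ^ k" using lam_props by (simp add: power_divide)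
      qed
      show "(\<lambda>k. (1 / lam) ^ k) \<longlonglongrightarrow> 0" using lam_props by (intro LIMSEQ_power_zero) auto
    qed
    thus "(\<lambda>k. 0 + 1 / lam ^ ?B k) \<longlonglongrightarrow> 0" by simp
  qed
  thus ?thesis using F0n_tendsto assms(1) by blast
qed

theorem theorem2:
  fixes x :: real and L :: enat and eps :: "nat \<Rightarrow> int" and a :: "nat \<Rightarrow> nat"
  assumes "x \<in> {0..1}"
    and "odd_cf_expansion x L eps a"
  shows "convergent (\<lambda>n. F0n n x) \<and>
    (case L of
       enat l \<Rightarrow> F0 x = - (\<Sum>i=1..l. of_int (cf_E eps i) / lam ^ cf_A a i)
     | \<infinity> \<Rightarrow> summable (\<lambda>i. of_int (cf_E eps (Suc i)) / lam ^ cf_A a (Suc i)) \<and>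
            F0 x = - (\<Sum>i. of_int (cf_E eps (Suc i)) / lam ^ cf_A a (Suc i)))"
proof (cases L)
  case (enat l)
  with F0n_tendsto_finite[of x l eps a] assms show ?thesis
    by (auto simp: F0_def convergent_def limI)
next
  case infinity
  have g: "good_digits eps a" and lim: "(\<lambda>m. cf_frac m eps a 1) \<longlonglongrightarrow> x"
    using assms(2) infinity by (auto simp: odd_cf_expansion_def odd_cf_digits_def good_digits_def)
  from F0n_tendsto_infinite[OF _ g lim] assms(1) summable_terms[OF g] infinity show ?thesis
    by (auto simp: F0_def convergent_def limI)
qed

end
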